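(* Let $D$ and $G$ be hyperbolic planar domains and $\Omega=D\times G\subset\mathbb{C}^2$. Suppose that $f:\mathbb{B}_2\to\Omega$ is holomorphic, $a\in\mathbb{B}_2$, $b=f(a)$, $u\in T_a\mathbb{C}^2$ and $u_*=f'(a)u$. Then $$\mathrm{Kob}_\Omega(b,u_* )=M_\Omega(b,u_* )\,|u_*|_e\ \leq\ M_{\mathbb{B}_2}(a,u)\,|u|_e ,$$ where, for $p=(c,d)\in\Omega$ and $v\in T_p\mathbb{C}^2$ making an angle of measure $\alpha$ with the $z_1$-plane, $$M_\Omega(p,v)=\max\{\mathrm{Hyp}_D(c)\cos\alpha,\ \mathrm{Hyp}_G(d)\sin\alpha\}.$$
   Context: $\mathbb{B}_2$ is the open unit ball of $\mathbb{C}^2$ with the standard Hermitian inner product $\langle\cdot,\cdot\rangle$; $|\cdot|_e$ is the Euclidean norm; $\mathbb{U}=\mathbb{D}$ is the open unit disk in $\mathbb{C}$. The angle $\alpha\in[0,\pi/2]$ between a vector $v=(v_1,v_2)\in\mathbb{C}^2$ and the $z_1$-plane is given by $|v_1|=\cos\alpha\,|v|_e$, $|v_2|=\sin\alpha\,|v|_e$. Kobayashi–Finsler norm: for a domain $\Omega$, $p\in\Omega$, $v\in T_p\Omega$, $\mathrm{Kob}_\Omega(p,v)=\inf|h|$ over all $h\in T_0\mathbb{C}\cong\mathbb{C}$ for which there is a holomorphic $\phi:\mathbb{U}\to\Omega$ with $\phi(0)=p$ and $d\phi_0(h)=v$. A plane domain $D$ is hyperbolic if its holomorphic universal covering is $\mathbb{D}$.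 The hyperbolic density is normalized by $\mathrm{Hyp}_{\mathbb{D}}(z)=\frac{2}{1-|z|^2}$ (Gaussian curvature $-1$), and $\mathrm{Hyp}_D(\pi(z))|\pi'(z)|=\mathrm{Hyp}_{\mathbb{D}}(z)$ for a holomorphic universal covering $\pi:\mathbb{D}\to D$. For $a\in\mathbb{B}_2$ put $s_a=(1-|a|^2)^{1/2}$, let $P_a$ be the orthogonal projection onto the complex line spanned by $a$ ($P_0=0$), $Q_a=I-P_a$, and $\varphi_a(z)=\frac{a-P_az-s_aQ_az}{1-\langle z,a\rangle}$, an automorphism of $\mathbb{B}_2$ with $\varphi_a(a)=0$. For $u\neq0$, $M_{\mathbb{B}_2}(a,u)=|(d\varphi_a)_au|_e/|u|_e$.
   Formalization: With Hyp normalized by 2/(1-|z|^2) and Kob = inf|h|, the claim fails (D=G=unit disk, f=id, a=0, u=(1,0): Kob=1, M_Omega|u_*|=2, M_B2|u|=1); the formal statement replaces M_Omega(b,u_* )|u_*| by half of it in both the equality and the inequality. *)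

theory Defs
  imports "HOL-Complex_Analysis.Complex_Analysis"
begin

no_notation fps_nth (infixl "$" 75)

section \<open>Hermitian geometry of the unit ball\<close>

definition herm :: "complex^2 \<Rightarrow> complex^2 \<Rightarrow> complex" where
  "herm z w = (\<Sum>i\<in>UNIV. z $ i * cnj (w $ i))"

lemma herm_self: "herm z z = complex_of_real ((norm z)\<^sup>2)"
proof -
  have "(norm z)\<^sup>2 = (cmod (z $ 1))\<^sup>2 + (cmod (z $ 2))\<^sup>2"
    by (simp add: norm_vec_def L2_set_def sum_2)
  then show ?thesis
    by (simp only: herm_def sum_2 of_real_add complex_norm_square)
qed

abbreviation unit_ball2 :: "(complex^2) set" where
  "unit_ball2 \<equiv> ball 0 1"

abbreviation unit_disk :: "complex set" where
  "unit_disk \<equiv> ball 0 1"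

text \<open>Division by zero makes the formula below give \<open>0\<close> for \<open>a = 0\<close>, as it should.\<close>

definition proj_line :: "complex^2 \<Rightarrow> complex^2 \<Rightarrow> complex^2" where
  "proj_line a z = (herm z a / herm a a) *s a"

lemma proj_line_0: "proj_line 0 z = 0"
  by (simp add: proj_line_def)

lemma proj_line_orthogonal: "herm (z - proj_line a z) (c *s a) = 0"
proof (cases "a = 0")
  case False
  then have "herm a a \<noteq> 0"
    by (simp add: herm_self)
  moreover have "herm (z - k *s a) (c *s a) = cnj c * (herm z a - k * herm a a)" for k
    unfolding herm_def sum_2
    by (simp only: vector_minus_component vector_smult_component complex_cnj_mult
        left_diff_distrib right_diff_distrib distrib_left distrib_right)
      (simp only: ac_simps diff_diff_eq add_diff_eq diff_add_eq diff_diff_eq2)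
  ultimately show ?thesis
    by (simp add: proj_line_def)
qed (simp add: herm_def)

definition ball_aut :: "complex^2 \<Rightarrow> complex^2 \<Rightarrow> complex^2" where
  "ball_aut a z =
     (1 / (1 - herm z a)) *s
       (a - proj_line a z - sqrt (1 - (norm a)\<^sup>2) *\<^sub>R (z - proj_line a z))"

text \<open>Only meaningful for \<open>u \<noteq> 0\<close>; at \<open>u = 0\<close> the value is \<open>0\<close>.\<close>

definition M_ball :: "complex^2 \<Rightarrow> complex^2 \<Rightarrow> real" where
  "M_ball a u = norm (frechet_derivative (ball_aut a) (at a) u) / norm u"


section \<open>Holomorphic maps and the Kobayashi norm\<close>

text \<open>
  The library's \<open>holomorphic_on\<close> is for functions of one variable. In several variables we ask
  for a Frechet derivative that is complex linear at every point of an open set.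
\<close>

definition holomorphic_map2 :: "(complex^2 \<Rightarrow> complex^2) \<Rightarrow> (complex^2) set \<Rightarrow> bool" where
  "holomorphic_map2 f S \<longleftrightarrow>
     open S \<and> (\<forall>z\<in>S. \<exists>A. (f has_derivative A) (at z) \<and> (\<forall>c v. A (c *s v) = c *s A v))"

definition holomorphic_disc :: "(complex \<Rightarrow> complex^2) \<Rightarrow> bool" where
  "holomorphic_disc \<phi> \<longleftrightarrow> (\<forall>i. (\<lambda>t. \<phi> t $ i) holomorphic_on unit_disk)"

definition Kob :: "(complex^2) set \<Rightarrow> complex^2 \<Rightarrow> complex^2 \<Rightarrow> real" where
  "Kob \<Omega> p v =
     Inf {cmod h | h. \<exists>\<phi>. holomorphic_disc \<phi> \<and> \<phi> ` unit_disk \<subseteq> \<Omega> \<and> \<phi> 0 = p \<and>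
                        frechet_derivative \<phi> (at 0) h = v}"


section \<open>Hyperbolic plane domains\<close>

text \<open>As the disk is simply connected, a covering of \<open>D\<close> by the disk is universal.\<close>

definition hol_universal_cover :: "(complex \<Rightarrow> complex) \<Rightarrow> complex set \<Rightarrow> bool" where
  "hol_universal_cover \<pi> D \<longleftrightarrow> \<pi> holomorphic_on unit_disk \<and> covering_space unit_disk \<pi> D"

definition hyperbolic_domain :: "complex set \<Rightarrow> bool" where
  "hyperbolic_domain D \<longleftrightarrow>
     open D \<and> connected D \<and> D \<noteq> {} \<and> (\<exists>\<pi>. hol_universal_cover \<pi> D)"

definition Hyp_disk :: "complex \<Rightarrow> real" where
  "Hyp_disk z = 2 / (1 - (cmod z)\<^sup>2)"

definition Hyp :: "complex set \<Rightarrow> complex \<Rightarrow> real" where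
  "Hyp D w =
     (THE r. \<forall>\<pi> z. hol_universal_cover \<pi> D \<and> z \<in> unit_disk \<and> \<pi> z = w
               \<longrightarrow> r * cmod (deriv \<pi> z) = Hyp_disk z)"


section \<open>Products of plane domains\<close>

definition prod_domain :: "complex set \<Rightarrow> complex set \<Rightarrow> (complex^2) set" where
  "prod_domain D G = {z. z $ 1 \<in> D \<and> z $ 2 \<in> G}"

definition angle_with_z1_plane :: "complex^2 \<Rightarrow> real \<Rightarrow> bool" where
  "angle_with_z1_plane v \<alpha> \<longleftrightarrow>
     \<alpha> \<in> {0..pi/2} \<and> cmod (v $ 1) = cos \<alpha> * norm v \<and> cmod (v $ 2) = sin \<alpha> * norm v"

lemma angle_with_z1_plane_exists: "\<exists>\<alpha>. angle_with_z1_plane v \<alpha>"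
proof (cases "v = 0")
  case True
  then show ?thesis
    by (intro exI[of _ 0]) (simp add: angle_with_z1_plane_def)
next
  case False
  have *: "(cmod (v $ 1))\<^sup>2 + (cmod (v $ 2))\<^sup>2 = (norm v)\<^sup>2"
    by (simp add: norm_vec_def L2_set_def sum_2)
  then have "(cmod (v $ 1) / norm v)\<^sup>2 + (cmod (v $ 2) / norm v)\<^sup>2 = 1"
    using False by (simp add: power_divide flip: add_divide_distrib)
  then obtain \<alpha> where \<alpha>: "0 \<le> \<alpha>" "\<alpha> \<le> pi/2"
      and cs: "cmod (v $ 1) / norm v = cos \<alpha>" "cmod (v $ 2) / norm v = sin \<alpha>"
    using sincos_total_pi_half[of "cmod (v $ 1) / norm v" "cmod (v $ 2) / norm v"] by auto
  have "angle_with_z1_plane v \<alpha>"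
    unfolding angle_with_z1_plane_def cs[symmetric] using \<alpha> False by simp
  then show ?thesis ..
qed

lemma angle_with_z1_plane_unique:
  assumes "v \<noteq> 0" "angle_with_z1_plane v \<alpha>" "angle_with_z1_plane v \<beta>"
  shows "\<alpha> = \<beta>"
proof -
  have "cos \<alpha> = cos \<beta>"
    using assms by (simp add: angle_with_z1_plane_def)
  moreover have "0 \<le> \<alpha>" "\<alpha> \<le> pi" "0 \<le> \<beta>" "\<beta> \<le> pi"
    using assms(2,3) pi_ge_zero unfolding angle_with_z1_plane_def atLeastAtMost_iff by linarith+
  ultimately show ?thesis
    using cos_inj_pi by blast
qed

text \<open>
  The angle is unique unless \<open>v = 0\<close>, where every angle qualifies; \<open>M_prod D G p v\<close> is then
  only ever multiplied by \<open>norm v = 0\<close>.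
\<close>

definition M_prod :: "complex set \<Rightarrow> complex set \<Rightarrow> complex^2 \<Rightarrow> complex^2 \<Rightarrow> real" where
  "M_prod D G p v =
     (let \<alpha> = (SOME \<alpha>. angle_with_z1_plane v \<alpha>)
      in max (Hyp D (p $ 1) * cos \<alpha>) (Hyp G (p $ 2) * sin \<alpha>))"

text \<open>
  \<open>Hyp\<close> has curvature \<open>-1\<close>, so it equals \<open>2\<close> at the centre of the disk, whereas \<open>Kob\<close> and
  \<open>M_ball\<close> are normalized so that a vector at the centre of the disk (resp. ball) has its
  Euclidean length. Comparing \<open>M_prod\<close> with \<open>Kob\<close> and \<open>M_ball\<close> therefore
  involves the factor \<open>1/2\<close>: for the bidisk and \<open>f z = z\<close>, \<open>a = 0\<close>, \<open>u = (1, 0)\<close>, one has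
  \<open>M_prod = 2\<close> but \<open>Kob = M_ball = 1\<close>.
\<close>

end

theory Submission
  imports Defs
begin

text \<open>
  Discs in \<open>D\<close> lift through a holomorphic covering, so Schwarz-Pick bounds their
  derivative at the centre by \<open>2 / Hyp D\<close>, and precomposing the covering with Moebius maps and
  contractions attains every derivative within the bound. A disc in \<open>D \<times> G\<close> is a pair of discs,
  which turns the Kobayashi norm into a maximum. A vector \<open>u\<close> at \<open>a\<close> is tangent to the image
  under \<open>ball_aut a\<close> of a complex line through the centre, and composing \<open>f\<close> with that disc
  yields a competitor of size \<open>M_ball a u * norm u\<close>.
\<close>

subsection \<open>Hyperbolic density and holomorphic discs\<close>

lemma Moebius_function_has_field_derivative:
  assumes "1 - cnj w * z \<noteq> 0"
  shows "(Moebius_function 0 w has_field_derivative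
           of_real (1 - (cmod w)\<^sup>2) / (1 - cnj w * z)\<^sup>2) (at z)"
proof -
  have "((\<lambda>z. (z - w) / (1 - cnj w * z)) has_field_derivative
          (1 - cnj w * w) / (1 - cnj w * z)\<^sup>2) (at z)"
    using assms by (auto intro!: derivative_eq_intros simp: power2_eq_square algebra_simps)
  moreover have "(1 - cnj w * w) = of_real (1 - (cmod w)\<^sup>2)"
    using complex_norm_square[of w] by (simp add: mult.commute)
  ultimately show ?thesis
    unfolding Moebius_function_simple[abs_def] by simp
qed

lemma one_minus_cmod_square_pos: "z \<in> unit_disk \<Longrightarrow> 0 < 1 - (cmod z)\<^sup>2"
  by (simp add: power_less_one_iff)

text \<open>Following \<open>g\<close> by the Moebius map that moves \<open>g 0\<close> to the
  origin reduces the bound to the Schwarz lemma; that map has derivative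
  \<open>1 / (1 - |g 0|^2)\<close> at \<open>g 0\<close>.\<close>

lemma Schwarz_Pick_at_0:
  assumes "g holomorphic_on unit_disk" "g \<in> unit_disk \<rightarrow> unit_disk"
  shows "cmod (deriv g 0) \<le> 1 - (cmod (g 0))\<^sup>2"
proof -
  define w where "w = g 0"
  have w: "cmod w < 1"
    using assms(2) by (auto simp: w_def)
  have pos: "0 < 1 - (cmod w)\<^sup>2"
    using w one_minus_cmod_square_pos[of w] by simp
  have ww: "1 - cnj w * w = of_real (1 - (cmod w)\<^sup>2)"
    using complex_norm_square[of w] by (simp add: mult.commute)
  define m where "m = Moebius_function 0 w"
  have "(m \<circ> g) holomorphic_on unit_disk"
    unfolding m_def
    by (rule holomorphic_on_compose_gen[OF assms(1) Moebius_function_holomorphic[OF w]])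
      (use assms(2) in auto)
  moreover have "(m \<circ> g) 0 = 0"
    by (simp add: m_def Moebius_function_eq_zero flip: w_def)
  moreover have "norm ((m \<circ> g) z) < 1" if "norm z < 1" for z
    using that assms(2) w by (auto simp: m_def intro!: Moebius_function_norm_lt_1)
  ultimately have le: "cmod (deriv (m \<circ> g) 0) \<le> 1"
    using Schwarz_Lemma(2)[of "m \<circ> g" 0] by auto
  have "(g has_field_derivative deriv g 0) (at 0)"
    using assms(1) by (simp add: holomorphic_derivI[where S = unit_disk])
  moreover have "(m has_field_derivative of_real (1 - (cmod w)\<^sup>2) / (1 - cnj w * w)\<^sup>2) (at (g 0))"
    unfolding m_def w_def[symmetric]
    by (rule Moebius_function_has_field_derivative) (use pos in \<open>simp add: ww del: of_real_diff\<close>)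
  ultimately have "deriv (m \<circ> g) 0 = of_real (1 - (cmod w)\<^sup>2) / (1 - cnj w * w)\<^sup>2 * deriv g 0"
    by (metis DERIV_chain DERIV_imp_deriv)
  then have "cmod (deriv (m \<circ> g) 0) = cmod (deriv g 0) / (1 - (cmod w)\<^sup>2)"
    unfolding ww using pos by (simp add: norm_mult norm_divide norm_power power2_eq_square del: of_real_diff)
  then show ?thesis
    using le pos by (simp add: w_def field_simps)
qed

text \<open>The disk is simply connected, so \<open>g\<close> lifts through \<open>\<pi>\<close> to
  a holomorphic self-map \<open>k\<close> of the disk with \<open>k 0 = z\<close>. The bound is
  Schwarz-Pick for \<open>k\<close>, multiplied by \<open>|deriv \<pi> z|\<close>.\<close>

lemma disc_deriv_le_covering_deriv:
  assumes cov: "hol_universal_cover \<pi> D"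
    and g: "g holomorphic_on unit_disk" "g \<in> unit_disk \<rightarrow> D"
    and z: "z \<in> unit_disk" "\<pi> z = g 0"
  shows "cmod (deriv g 0) \<le> cmod (deriv \<pi> z) * (1 - (cmod z)\<^sup>2)"
proof -
  have \<pi>: "\<pi> holomorphic_on unit_disk" "covering_space unit_disk \<pi> D"
    using cov by (auto simp: hol_universal_cover_def)
  obtain k where k: "continuous_on unit_disk k" "k \<in> unit_disk \<rightarrow> unit_disk" "k 0 = z"
    "\<And>y. y \<in> unit_disk \<Longrightarrow> \<pi> (k y) = g y"
    by (rule covering_space_lift_strong[OF \<pi>(2) z(1), of 0 unit_disk g])
      (use g z in \<open>auto simp: convex_imp_simply_connected convex_imp_locally_path_connected
                         intro: holomorphic_on_imp_continuous_on\<close>)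
  have holk: "k holomorphic_on unit_disk"
    by (rule covering_space_lift_is_holomorphic[OF \<pi>(2) _ \<pi>(1) g k(2,1,4)]) auto
  have "(\<pi> has_field_derivative deriv \<pi> z) (at (k 0))"
    using \<pi>(1) z(1) k(3) by (auto intro: holomorphic_derivI)
  moreover have "(k has_field_derivative deriv k 0) (at 0)"
    using holk by (simp add: holomorphic_derivI[where S = unit_disk])
  ultimately have "((\<pi> \<circ> k) has_field_derivative deriv \<pi> z * deriv k 0) (at 0)"
    by (rule DERIV_chain)
  \<comment> \<open>\<open>\<pi> \<circ> k\<close> and \<open>g\<close> agree on the disk only, but
    the disk is an open neighbourhood of \<open>0\<close>.\<close>
  then have "(g has_field_derivative deriv \<pi> z * deriv k 0) (at 0)"
    by (rule has_field_derivative_transform_within_open[where S = unit_disk]) (use k(4) in auto)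
  then have "deriv g 0 = deriv \<pi> z * deriv k 0"
    by (rule DERIV_imp_deriv)
  then show ?thesis
    using Schwarz_Pick_at_0[OF holk k(2)] k(3) by (simp add: norm_mult mult_left_mono)
qed

text \<open>The disc is \<open>\<pi>\<close> after a Moebius map moving \<open>0\<close> to
  \<open>z\<close>, after multiplication by \<open>c\<close>. The case \<open>|c| = 1\<close> gives
  the largest derivative; smaller \<open>c\<close> shrinks it, and the argument of \<open>c\<close>
  turns it.\<close>

lemma disc_with_scaled_covering_deriv:
  assumes \<pi>: "\<pi> holomorphic_on unit_disk" "\<pi> \<in> unit_disk \<rightarrow> D"
    and z: "z \<in> unit_disk" and c: "cmod c \<le> 1"
  obtains g where "g holomorphic_on unit_disk" "g \<in> unit_disk \<rightarrow> D" "g 0 = \<pi> z"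
    "deriv g 0 = c * (of_real (1 - (cmod z)\<^sup>2) * deriv \<pi> z)"
proof -
  \<comment> \<open>The parameter is \<open>- z\<close> because \<open>Moebius_function 0 w\<close>
    sends \<open>0\<close> to \<open>- w\<close>.\<close>
  define m where "m = Moebius_function 0 (- z)"
  have mi: "m \<in> unit_disk \<rightarrow> unit_disk"
    using z by (auto simp: m_def intro!: Moebius_function_norm_lt_1)
  have holm: "m holomorphic_on unit_disk"
    unfolding m_def by (rule Moebius_function_holomorphic) (use z in simp)
  have m0: "m 0 = z"
    by (simp add: m_def Moebius_function_of_zero)
  have dm: "(m has_field_derivative of_real (1 - (cmod z)\<^sup>2)) (at 0)"
    using Moebius_function_has_field_derivative[of "- z" 0] by (simp add: m_def)
  have sc: "c * t \<in> unit_disk" if "t \<in> unit_disk" for t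
  proof -
    have "cmod c * cmod t \<le> 1 * cmod t"
      by (rule mult_right_mono) (use c in auto)
    then show ?thesis using that by (simp add: norm_mult)
  qed
  define g where "g = \<pi> \<circ> (m \<circ> (\<lambda>t. c * t))"
  have "(\<lambda>t. c * t) holomorphic_on unit_disk"
    by (intro holomorphic_intros)
  then have hm: "(m \<circ> (\<lambda>t. c * t)) holomorphic_on unit_disk"
    by (rule holomorphic_on_compose_gen[OF _ holm]) (use sc in auto)
  have hg: "g holomorphic_on unit_disk"
    unfolding g_def by (rule holomorphic_on_compose_gen[OF hm \<pi>(1)]) (use sc mi in auto)
  have gi: "g \<in> unit_disk \<rightarrow> D"
    using sc mi \<pi>(2) by (auto simp: g_def Pi_iff)
  have "((\<lambda>t. c * t) has_field_derivative c) (at 0)"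
    by (auto intro!: derivative_eq_intros)
  then have "((m \<circ> (\<lambda>t. c * t)) has_field_derivative of_real (1 - (cmod z)\<^sup>2) * c) (at 0)"
    by (intro DERIV_chain) (use dm in auto)
  moreover have "(\<pi> has_field_derivative deriv \<pi> z) (at z)"
    using \<pi>(1) z by (auto intro: holomorphic_derivI)
  ultimately have "(g has_field_derivative deriv \<pi> z * (of_real (1 - (cmod z)\<^sup>2) * c)) (at 0)"
    unfolding g_def by (metis DERIV_chain comp_apply m0 mult_zero_right)
  then show thesis
    using that[OF hg gi] m0 by (auto simp: g_def DERIV_imp_deriv ac_simps)
qed

section \<open>The hyperbolic density computed from a covering\<close>

lemma hol_universal_cover_image: "hol_universal_cover \<pi> D \<Longrightarrow> \<pi> \<in> unit_disk \<rightarrow> D"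
  using covering_space_imp_surjective by (fastforce simp: hol_universal_cover_def)

text \<open>A covering is injective near each point, and an injective holomorphic function has no
  critical points.\<close>

lemma hol_universal_cover_deriv_nonzero:
  assumes "hol_universal_cover \<pi> D" "z \<in> unit_disk"
  shows "deriv \<pi> z \<noteq> 0"
proof -
  have \<pi>: "\<pi> holomorphic_on unit_disk" "covering_space unit_disk \<pi> D"
    using assms by (auto simp: hol_universal_cover_def)
  obtain T u q where "z \<in> T" "openin (top_of_set unit_disk) T" "homeomorphism T u \<pi> q"
    using covering_space_local_homeomorphism[OF \<pi>(2) assms(2)] by metis
  moreover from this have "open T" "T \<subseteq> unit_disk"
    using openin_open_eq open_ball by blast+
  moreover have "inj_on \<pi> T"
    using \<open>homeomorphism T u \<pi> q\<close> by (metis homeomorphism_def inj_on_inverseI)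
  ultimately show ?thesis
    using holomorphic_injective_imp_regular \<pi>(1) holomorphic_on_subset by metis
qed

text \<open>Justifies the definite description in \<open>Hyp\<close>: the quantity
  \<open>|deriv \<pi> z| * (1 - |z|^2)\<close> depends only on the point \<open>\<pi> z\<close>, not
  on the covering or the preimage.\<close>

lemma Hyp_covering:
  assumes "hol_universal_cover \<pi> D" "z \<in> unit_disk"
  shows "Hyp D (\<pi> z) = 2 / (cmod (deriv \<pi> z) * (1 - (cmod z)\<^sup>2))"
proof -
  \<comment> \<open>Lifting the recentred covering \<open>\<rho>\<close> through
    \<open>\<pi>\<close> gives one inequality. It is stated for arbitrary pairs so that exchanging
    the two coverings gives equality.\<close>
  have le: "cmod (deriv \<rho> y) * (1 - (cmod y)\<^sup>2) \<le> cmod (deriv \<pi> z) * (1 - (cmod z)\<^sup>2)"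
    if cov: "hol_universal_cover \<rho> D" "hol_universal_cover \<pi> D"
      and yz: "y \<in> unit_disk" "z \<in> unit_disk" "\<rho> y = \<pi> z" for \<rho> \<pi> y z
  proof -
    have hol: "\<rho> holomorphic_on unit_disk"
      using cov(1) by (simp add: hol_universal_cover_def)
    obtain g where g: "g holomorphic_on unit_disk" "g \<in> unit_disk \<rightarrow> D" "g 0 = \<rho> y"
      "deriv g 0 = 1 * (of_real (1 - (cmod y)\<^sup>2) * deriv \<rho> y)"
      using disc_with_scaled_covering_deriv[OF hol hol_universal_cover_image[OF cov(1)] yz(1), of 1]
      by auto
    have "cmod (deriv g 0) = (1 - (cmod y)\<^sup>2) * cmod (deriv \<rho> y)"
      using one_minus_cmod_square_pos[OF yz(1)] by (simp add: g norm_mult del: of_real_diff)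
    then show ?thesis
      using disc_deriv_le_covering_deriv[OF cov(2) g(1,2) yz(2)] g(3) yz(3)
      by (simp add: mult.commute)
  qed
  show ?thesis
    unfolding Hyp_def
  proof (rule the_equality, intro allI impI, elim conjE)
    fix \<rho> y
    assume \<rho>: "hol_universal_cover \<rho> D" "y \<in> unit_disk" "\<rho> y = \<pi> z"
    have "cmod (deriv \<rho> y) * (1 - (cmod y)\<^sup>2) = cmod (deriv \<pi> z) * (1 - (cmod z)\<^sup>2)"
      using le[of \<rho> \<pi> y z] le[of \<pi> \<rho> z y] \<rho> assms by auto
    then show "2 / (cmod (deriv \<pi> z) * (1 - (cmod z)\<^sup>2)) * cmod (deriv \<rho> y) = Hyp_disk y"
      using one_minus_cmod_square_pos[OF \<rho>(2)] hol_universal_cover_deriv_nonzero[OF \<rho>(1,2)]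
      by (simp add: Hyp_disk_def flip: \<open>cmod (deriv \<rho> y) * _ = _\<close>)
  next
    fix r
    assume "\<forall>\<rho> y. hol_universal_cover \<rho> D \<and> y \<in> unit_disk \<and> \<rho> y = \<pi> z \<longrightarrow>
      r * cmod (deriv \<rho> y) = Hyp_disk y"
    then have "r * cmod (deriv \<pi> z) = Hyp_disk z"
      using assms by blast
    then show "r = 2 / (cmod (deriv \<pi> z) * (1 - (cmod z)\<^sup>2))"
      using one_minus_cmod_square_pos[OF assms(2)] hol_universal_cover_deriv_nonzero[OF assms]
      by (auto simp: Hyp_disk_def field_simps)
  qed
qed

lemma hyperbolic_domain_covering_point:
  assumes "hyperbolic_domain D" "w \<in> D"
  obtains \<pi> z where "hol_universal_cover \<pi> D" "z \<in> unit_disk" "\<pi> z = w"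
  using assms covering_space_imp_surjective
  unfolding hyperbolic_domain_def hol_universal_cover_def by (metis imageE)

lemma Hyp_pos:
  assumes "hyperbolic_domain D" "w \<in> D"
  shows "0 < Hyp D w"
proof -
  obtain \<pi> z where \<pi>: "hol_universal_cover \<pi> D" "z \<in> unit_disk" "\<pi> z = w"
    using hyperbolic_domain_covering_point[OF assms] .
  then show ?thesis
    using Hyp_covering[OF \<pi>(1,2)] one_minus_cmod_square_pos hol_universal_cover_deriv_nonzero
    by simp
qed

text \<open>The density cancels the factor in \<open>disc_deriv_le_covering_deriv\<close>; the
  constant \<open>2\<close> is the density of the disk at its centre.\<close>

lemma Hyp_deriv_disc_le:
  assumes "hyperbolic_domain D" "g holomorphic_on unit_disk" "g \<in> unit_disk \<rightarrow> D"
  shows "Hyp D (g 0) * cmod (deriv g 0) \<le> 2"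
proof -
  have "g 0 \<in> D"
    using assms(3) by (auto simp: Pi_iff)
  then obtain \<pi> z where \<pi>: "hol_universal_cover \<pi> D" "z \<in> unit_disk" "\<pi> z = g 0"
    using hyperbolic_domain_covering_point[OF assms(1)] by metis
  then have "0 < cmod (deriv \<pi> z) * (1 - (cmod z)\<^sup>2)"
    using one_minus_cmod_square_pos hol_universal_cover_deriv_nonzero by simp
  then show ?thesis
    using Hyp_covering[OF \<pi>(1,2)] disc_deriv_le_covering_deriv[OF \<pi>(1) assms(2,3) \<pi>(2,3)] \<pi>(3)
    by (simp add: field_simps)
qed

text \<open>Shows that the bound in \<open>Hyp_deriv_disc_le\<close> is sharp, with every admissible
  derivative realized.\<close>

lemma disc_with_deriv:
  assumes "hyperbolic_domain D" "w \<in> D" "Hyp D w * cmod v \<le> 2"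
  obtains g where "g holomorphic_on unit_disk" "g \<in> unit_disk \<rightarrow> D" "g 0 = w" "deriv g 0 = v"
proof -
  obtain \<pi> z where \<pi>: "hol_universal_cover \<pi> D" "z \<in> unit_disk" "\<pi> z = w"
    using hyperbolic_domain_covering_point[OF assms(1,2)] .
  have hol: "\<pi> holomorphic_on unit_disk"
    using \<pi>(1) by (simp add: hol_universal_cover_def)
  \<comment> \<open>\<open>k\<close> is the derivative at \<open>0\<close> of the recentred covering
    and \<open>Hyp D w = 2 / |k|\<close>, so the assumption on \<open>v\<close> says exactly that
    the scaling factor \<open>v / k\<close> lies in the closed disk.\<close>
  define k where "k = of_real (1 - (cmod z)\<^sup>2) * deriv \<pi> z"
  have k: "cmod k = cmod (deriv \<pi> z) * (1 - (cmod z)\<^sup>2)" "k \<noteq> 0"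
    using one_minus_cmod_square_pos[OF \<pi>(2)] hol_universal_cover_deriv_nonzero[OF \<pi>(1,2)]
    by (auto simp: k_def norm_mult simp del: of_real_diff)
  then have "Hyp D w = 2 / cmod k"
    using Hyp_covering[OF \<pi>(1,2)] \<pi>(3) by simp
  then have "cmod (v / k) \<le> 1"
    using assms(3) k(2) by (simp add: norm_divide pos_divide_le_eq)
  then obtain g where "g holomorphic_on unit_disk" "g \<in> unit_disk \<rightarrow> D" "g 0 = \<pi> z"
    "deriv g 0 = v / k * k"
    using disc_with_scaled_covering_deriv[OF hol hol_universal_cover_image[OF \<pi>(1)] \<pi>(2)]
    unfolding k_def by metis
  then show thesis
    using that \<pi>(3) k(2) by simp
qed

subsection \<open>The Kobayashi norm of a product domain\<close>

lemma norm_vector_scalar_mult: "norm (c *s v) = cmod c * norm v" for v :: "complex^'n"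
  by (simp add: norm_vec_def norm_mult L2_set_right_distrib)

lemma bounded_bilinear_vector_scalar_mult:
  "bounded_bilinear ((*s) :: complex \<Rightarrow> complex^'n \<Rightarrow> complex^'n)"
  by standard
    (auto simp: vec_eq_iff algebra_simps norm_vector_scalar_mult intro!: exI[of _ 1])

text \<open>Expanding in the standard basis leaves a finite sum of scalar functions times fixed
  vectors.\<close>

lemma has_derivative_vec_nthI:
  fixes f :: "'a::real_normed_vector \<Rightarrow> complex^'n"
  assumes "\<And>i. ((\<lambda>x. f x $ i) has_derivative (\<lambda>x. f' x $ i)) F"
  shows "(f has_derivative f') F"
proof -
  have "((\<lambda>x. \<Sum>i\<in>UNIV. f x $ i *s axis i 1) has_derivative (\<lambda>x. \<Sum>i\<in>UNIV. f' x $ i *s axis i 1)) F"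
    by (intro has_derivative_sum
        bounded_linear.has_derivative[OF bounded_bilinear.bounded_linear_left
          [OF bounded_bilinear_vector_scalar_mult]] assms)
  then show ?thesis
    by (simp add: basis_expansion)
qed

text \<open>Translates the tangent condition in \<open>Kob\<close> into conditions on the complex
  derivatives of the separate components.\<close>

lemma holomorphic_disc_frechet_derivative:
  assumes "holomorphic_disc \<phi>"
  shows "frechet_derivative \<phi> (at 0) h = (\<chi> i. deriv (\<lambda>t. \<phi> t $ i) 0 * h)"
proof -
  have "(\<phi> has_derivative (\<lambda>h. \<chi> i. deriv (\<lambda>t. \<phi> t $ i) 0 * h)) (at 0)"
  proof (rule has_derivative_vec_nthI)
    fix i
    have "((\<lambda>t. \<phi> t $ i) has_field_derivative deriv (\<lambda>t. \<phi> t $ i) 0) (at 0)"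
      using assms by (simp add: holomorphic_disc_def holomorphic_derivI[where S = unit_disk])
    then show "((\<lambda>x. \<phi> x $ i) has_derivative (\<lambda>h. (\<chi> i. deriv (\<lambda>t. \<phi> t $ i) 0 * h) $ i)) (at 0)"
      by (simp add: has_field_derivative_def)
  qed
  then show ?thesis
    by (metis frechet_derivative_at)
qed

text \<open>The norm turns the cosine and sine into the moduli of the components, so the choice of
  angle disappears; for \<open>v = 0\<close> both sides vanish.\<close>

lemma M_prod_times_norm:
  "M_prod D G p v * norm v = max (Hyp D (p $ 1) * cmod (v $ 1)) (Hyp G (p $ 2) * cmod (v $ 2))"
proof -
  define \<alpha> where "\<alpha> = (SOME \<alpha>. angle_with_z1_plane v \<alpha>)"
  have "angle_with_z1_plane v \<alpha>"
    unfolding \<alpha>_def by (rule someI_ex[OF angle_with_z1_plane_exists])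
  then show ?thesis
    unfolding M_prod_def Let_def \<alpha>_def[symmetric]
    by (simp add: angle_with_z1_plane_def max_mult_distrib_right mult.assoc)
qed

lemma Hyp_disc_component_le:
  assumes "hyperbolic_domain D" "holomorphic_disc \<phi>" "\<And>t. t \<in> unit_disk \<Longrightarrow> \<phi> t $ i \<in> D"
    and "frechet_derivative \<phi> (at 0) h = v"
  shows "Hyp D (\<phi> 0 $ i) * cmod (v $ i) \<le> 2 * cmod h"
proof -
  have "Hyp D (\<phi> 0 $ i) * cmod (deriv (\<lambda>t. \<phi> t $ i) 0) \<le> 2"
    by (rule Hyp_deriv_disc_le) (use assms in \<open>auto simp: holomorphic_disc_def\<close>)
  moreover have "v $ i = deriv (\<lambda>t. \<phi> t $ i) 0 * h"
    using holomorphic_disc_frechet_derivative[OF assms(2)] assms(4) by auto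
  ultimately show ?thesis
    using mult_right_mono[OF _ norm_ge_zero[of h], of _ 2] by (fastforce simp: norm_mult mult.assoc)
qed

text \<open>Each component of the disc is a disc in its own factor and obeys the one-variable bound;
  the maximum collects the two. The \<open>1/2\<close> cancels the density \<open>2\<close> at the
  centre of the disk.\<close>

lemma M_prod_le_disc:
  assumes "hyperbolic_domain D" "hyperbolic_domain G"
    and "holomorphic_disc \<phi>" "\<phi> ` unit_disk \<subseteq> prod_domain D G"
    and "\<phi> 0 = p" "frechet_derivative \<phi> (at 0) h = v"
  shows "(1/2) * (M_prod D G p v * norm v) \<le> cmod h"
proof -
  have "\<phi> t $ 1 \<in> D" "\<phi> t $ 2 \<in> G" if "t \<in> unit_disk" for t
    using assms(4) that by (auto simp: prod_domain_def image_subset_iff)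
  then show ?thesis
    using Hyp_disc_component_le[OF assms(1,3) _ assms(6), of 1]
      Hyp_disc_component_le[OF assms(2,3) _ assms(6), of 2] assms(5)
    by (simp add: M_prod_times_norm)
qed

text \<open>The two components of a disc in a product can be chosen independently, so extremal
  one-variable discs combine to an extremal disc.\<close>

lemma M_prod_attained:
  assumes D: "hyperbolic_domain D" and G: "hyperbolic_domain G" and p: "p \<in> prod_domain D G"
  obtains \<phi> where "holomorphic_disc \<phi>" "\<phi> ` unit_disk \<subseteq> prod_domain D G" "\<phi> 0 = p"
    "frechet_derivative \<phi> (at 0) (of_real ((1/2) * (M_prod D G p v * norm v))) = v"
proof -
  define m where "m = (1/2) * (M_prod D G p v * norm v)"
  have p1: "p $ 1 \<in> D" and p2: "p $ 2 \<in> G"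
    using p by (auto simp: prod_domain_def)
  note pos = Hyp_pos[OF D p1] Hyp_pos[OF G p2]
  have le: "Hyp D (p $ 1) * cmod (v $ 1) \<le> 2 * m" "Hyp G (p $ 2) * cmod (v $ 2) \<le> 2 * m"
    by (auto simp: m_def M_prod_times_norm)
  have "0 \<le> Hyp D (p $ 1) * cmod (v $ 1)"
    using pos by simp
  then have m: "0 \<le> m"
    using le(1) by linarith
  \<comment> \<open>In the degenerate case the quotients \<open>v $ i / of_real m\<close> below are
    \<open>0\<close> by default. This is harmless, since positive densities force
    \<open>v = 0\<close>.\<close>
  have v0: "v $ 1 = 0" "v $ 2 = 0" if "m = 0"
    using le pos that by (auto simp: mult_le_0_iff)
  have le2: "Hyp D (p $ 1) * cmod (v $ 1 / of_real m) \<le> 2" "Hyp G (p $ 2) * cmod (v $ 2 / of_real m) \<le> 2"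
    using le m by (auto simp: norm_divide divide_simps)
  obtain g1 where g1: "g1 holomorphic_on unit_disk" "g1 \<in> unit_disk \<rightarrow> D" "g1 0 = p $ 1"
    "deriv g1 0 = v $ 1 / of_real m"
    using disc_with_deriv[OF D p1 le2(1)] .
  obtain g2 where g2: "g2 holomorphic_on unit_disk" "g2 \<in> unit_disk \<rightarrow> G" "g2 0 = p $ 2"
    "deriv g2 0 = v $ 2 / of_real m"
    using disc_with_deriv[OF G p2 le2(2)] .
  define \<phi> :: "complex \<Rightarrow> complex^2" where "\<phi> t = vector [g1 t, g2 t]" for t
  have \<phi>: "\<phi> t $ 1 = g1 t" "\<phi> t $ 2 = g2 t" for t
    by (simp_all add: \<phi>_def)
  have hol: "holomorphic_disc \<phi>"
    using g1(1) g2(1) by (simp add: holomorphic_disc_def forall_2 \<phi>)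
  moreover have "\<phi> ` unit_disk \<subseteq> prod_domain D G"
    using g1(2) g2(2) by (auto simp: prod_domain_def \<phi>)
  moreover have "\<phi> 0 = p"
    using g1(3) g2(3) by (simp add: vec_eq_iff forall_2 \<phi>)
  moreover have "frechet_derivative \<phi> (at 0) (of_real m) = v"
    using v0 by (auto simp: holomorphic_disc_frechet_derivative[OF hol] vec_eq_iff forall_2 \<phi> g1(4) g2(4))
  ultimately show thesis
    using that by (simp add: m_def)
qed

lemma Kob_prod_domain:
  assumes "hyperbolic_domain D" "hyperbolic_domain G" "p \<in> prod_domain D G"
  shows "Kob (prod_domain D G) p v = (1/2) * (M_prod D G p v * norm v)"
proof -
  define m where "m = (1/2) * (M_prod D G p v * norm v)"
  obtain \<phi> where \<phi>: "holomorphic_disc \<phi>" "\<phi> ` unit_disk \<subseteq> prod_domain D G" "\<phi> 0 = p"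
    "frechet_derivative \<phi> (at 0) (of_real m) = v"
    using M_prod_attained[OF assms, of v] unfolding m_def .
  \<comment> \<open>Competitors in \<open>Kob\<close> are moduli, so \<open>m\<close> must be
    nonnegative for \<open>of_real m\<close> to have size \<open>m\<close>. The infimum is then a
    minimum.\<close>
  have "0 \<le> Hyp D (p $ 1) * cmod (v $ 1)"
    using Hyp_pos[of D "p $ 1"] assms by (simp add: prod_domain_def)
  then have "0 \<le> m"
    by (simp add: m_def M_prod_times_norm le_max_iff_disj)
  then have "cmod (of_real m) = m"
    by simp
  show ?thesis
    unfolding Kob_def m_def[symmetric]
  proof (rule cInf_eq_minimum)
    show "m \<in> {cmod h | h. \<exists>\<phi>. holomorphic_disc \<phi> \<and> \<phi> ` unit_disk \<subseteq> prod_domain D G \<and> \<phi> 0 = p \<and>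
                        frechet_derivative \<phi> (at 0) h = v}"
      using \<phi> \<open>cmod (of_real m) = m\<close> by (intro CollectI exI[of _ "of_real m"]) auto
  qed (use M_prod_le_disc[OF assms(1,2)] in \<open>auto simp only: m_def\<close>)
qed

text \<open>By the chain rule and complex linearity of both derivatives, the derivative along
  \<open>t *s e\<close> is \<open>h\<close> times a fixed vector, which is complex differentiability
  of each component.\<close>

lemma holomorphic_map2_disc:
  assumes f: "holomorphic_map2 f S" and g: "holomorphic_map2 g T" "g ` T \<subseteq> S"
    and e: "\<And>t. t \<in> unit_disk \<Longrightarrow> t *s e \<in> T"
  shows "holomorphic_disc (\<lambda>t. f (g (t *s e)))" (is ?hol)
    and "frechet_derivative (\<lambda>t. f (g (t *s e))) (at 0) h =
           frechet_derivative f (at (g 0)) (frechet_derivative g (at 0) (h *s e))" (is ?der)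
proof -
  have der: "\<exists>A B. (f has_derivative A) (at (g (t *s e))) \<and> (g has_derivative B) (at (t *s e)) \<and>
     ((\<lambda>t. f (g (t *s e))) has_derivative (\<lambda>h. A (B (h *s e)))) (at t) \<and>
     (\<forall>h. A (B (h *s e)) = h *s A (B e))"
    if t: "t \<in> unit_disk" for t
  proof -
    obtain B where B: "(g has_derivative B) (at (t *s e))" "\<And>c v. B (c *s v) = c *s B v"
      using g(1) e[OF t] by (auto simp: holomorphic_map2_def)
    obtain A where A: "(f has_derivative A) (at (g (t *s e)))" "\<And>c v. A (c *s v) = c *s A v"
      using f g(2) e[OF t] by (fastforce simp: holomorphic_map2_def)
    have "((\<lambda>t. t *s e) has_derivative (\<lambda>h. h *s e)) (at t)"
      by (rule bounded_linear_imp_has_derivative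
          [OF bounded_bilinear.bounded_linear_left[OF bounded_bilinear_vector_scalar_mult]])
    from has_derivative_compose[OF has_derivative_compose[OF this B(1)] A(1)]
    show ?thesis
      using A B by (intro exI[of _ A] exI[of _ B]) simp
  qed
  show ?hol
    unfolding holomorphic_disc_def
  proof (intro allI holomorphic_onI)
    fix i t
    assume "t \<in> unit_disk"
    from der[OF this] obtain A B
      where "(f has_derivative A) (at (g (t *s e)))" "(g has_derivative B) (at (t *s e))"
        and AB: "((\<lambda>t. f (g (t *s e))) has_derivative (\<lambda>h. A (B (h *s e)))) (at t)"
          "\<forall>h. A (B (h *s e)) = h *s A (B e)"
      by (elim exE conjE) (rule that, assumption+)
    have "((\<lambda>t. f (g (t *s e)) $ i) has_derivative (\<lambda>h. A (B (h *s e)) $ i)) (at t)"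
      by (rule bounded_linear.has_derivative[OF bounded_linear_vec_nth AB(1)])
    then have "((\<lambda>t. f (g (t *s e)) $ i) has_field_derivative A (B e) $ i) (at t)"
      by (simp add: has_field_derivative_def AB(2)[rule_format] mult_commute_abs)
    then show "(\<lambda>t. f (g (t *s e)) $ i) field_differentiable at t within unit_disk"
      using field_differentiable_at_within field_differentiable_def by blast
  qed
  have "0 \<in> unit_disk"
    by simp
  from der[OF this] obtain A B
    where AB: "(f has_derivative A) (at (g (0 *s e)))" "(g has_derivative B) (at (0 *s e))"
      "((\<lambda>t. f (g (t *s e))) has_derivative (\<lambda>h. A (B (h *s e)))) (at 0)"
    by (elim exE conjE) (rule that, assumption+)
  show ?der
    using AB(1,2)[THEN frechet_derivative_at] AB(3)[THEN frechet_derivative_at, symmetric] by simp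
qed

subsection \<open>Discs in the ball\<close>

lemma herm_simps:
  "herm (z + w) a = herm z a + herm w a"
  "herm (z - w) a = herm z a - herm w a"
  "herm (- z) a = - herm z a"
  "herm (c *s z) a = c * herm z a"
  "herm (r *\<^sub>R z) a = r *\<^sub>R herm z a"
  "herm z (w + a) = herm z w + herm z a"
  "herm z (w - a) = herm z w - herm z a"
  "herm z (c *s a) = cnj c * herm z a"
  "herm 0 a = 0" "herm a 0 = 0"
  by (simp_all add: herm_def sum_2 algebra_simps)

lemma herm_commute: "herm w z = cnj (herm z w)"
  by (simp add: herm_def mult.commute)

lemma herm_eq_0_iff: "herm a a = 0 \<longleftrightarrow> a = 0"
  by (simp add: herm_self)

lemma bounded_linear_herm: "bounded_linear (\<lambda>z. herm z a)"
  unfolding herm_def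
  by (intro bounded_linear_sum bounded_linear_mult_const bounded_linear_vec_nth)

text \<open>The Cauchy-Schwarz inequality, obtained from its real form for the moduli of the
  coordinates.\<close>

lemma cmod_herm_le: "cmod (herm z w) \<le> norm z * norm w"
proof -
  have "cmod (herm z w) \<le> (\<Sum>i\<in>UNIV. \<bar>norm (z $ i)\<bar> * \<bar>norm (w $ i)\<bar>)"
    unfolding herm_def by (rule order.trans[OF norm_sum]) (simp add: norm_mult)
  also have "\<dots> \<le> norm z * norm w"
    unfolding norm_vec_def by (rule L2_set_mult_ineq)
  finally show ?thesis .
qed

lemma herm_proj_line: "herm (proj_line a z) a = herm z a"
  by (cases "a = 0") (simp_all add: proj_line_def herm_simps herm_eq_0_iff)

lemma proj_line_scale: "proj_line a (c *s z) = c *s proj_line a z"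
  by (simp add: proj_line_def herm_simps vector_smult_assoc)

lemma proj_line_idem: "proj_line a (proj_line a z) = proj_line a z"
  by (simp add: proj_line_def[of a "proj_line a z"] herm_proj_line) (simp add: proj_line_def)

lemma bounded_linear_proj_line: "bounded_linear (proj_line a)"
  unfolding proj_line_def[abs_def] divide_inverse
  by (intro bounded_linear_compose[OF bounded_bilinear.bounded_linear_left
        [OF bounded_bilinear_vector_scalar_mult]] bounded_linear_mult_const bounded_linear_herm)

lemma herm_scale_eq_proj_line: "herm z a *s a = of_real ((norm a)\<^sup>2) *s proj_line a z"
  by (cases "a = 0") (simp_all add: proj_line_def vector_smult_assoc herm_self)

text \<open>The operator \<open>P_a + s_a Q_a\<close>. Isolating it exhibits the automorphism as an
  affine map divided by an affine function.\<close>

definition ball_aut_lin :: "complex^2 \<Rightarrow> complex^2 \<Rightarrow> complex^2" where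
  "ball_aut_lin a z = proj_line a z + sqrt (1 - (norm a)\<^sup>2) *\<^sub>R (z - proj_line a z)"

lemma ball_aut_eq: "ball_aut a z = (1 / (1 - herm z a)) *s (a - ball_aut_lin a z)"
  by (simp add: ball_aut_def ball_aut_lin_def algebra_simps)

lemma ball_aut_lin_self: "ball_aut_lin a a = a"
  by (cases "a = 0") (simp_all add: ball_aut_lin_def proj_line_def herm_eq_0_iff)

lemma ball_aut_lin_scale: "ball_aut_lin a (c *s z) = c *s ball_aut_lin a z"
  by (simp add: ball_aut_lin_def proj_line_scale vec_eq_iff algebra_simps)

lemma bounded_linear_ball_aut_lin: "bounded_linear (ball_aut_lin a)"
  unfolding ball_aut_lin_def[abs_def]
  by (intro bounded_linear_add bounded_linear_sub bounded_linear_proj_line bounded_linear_ident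
      bounded_linear_const_scaleR)

lemma herm_ball_aut_lin: "herm (ball_aut_lin a z) a = herm z a"
  by (simp add: ball_aut_lin_def herm_simps herm_proj_line)

text \<open>\<open>P_a\<close> and \<open>Q_a\<close> are complementary projections, so squaring
  \<open>P_a + s_a Q_a\<close> only squares the coefficient \<open>s_a\<close>.\<close>

lemma ball_aut_lin_twice:
  assumes "norm a \<le> 1"
  shows "ball_aut_lin a (ball_aut_lin a z) =
           proj_line a z + of_real (1 - (norm a)\<^sup>2) *s (z - proj_line a z)"
proof -
  interpret P: bounded_linear "proj_line a"
    by (rule bounded_linear_proj_line)
  define s where "s = sqrt (1 - (norm a)\<^sup>2)"
  have s: "1 - (norm a)\<^sup>2 = s * s" "0 \<le> s"
    using assms by (simp_all add: s_def power_le_one)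
  have "proj_line a (ball_aut_lin a z) = proj_line a z"
    by (simp add: ball_aut_lin_def P.add P.diff P.scaleR proj_line_idem)
  then show ?thesis
    unfolding ball_aut_lin_def[of a "ball_aut_lin a z"] s_def[symmetric] s(1)
    by (simp add: ball_aut_lin_def vec_eq_iff algebra_simps flip: s_def)
      (simp add: scaleR_conv_of_real s(2))
qed

section \<open>Derivative and range of the ball automorphism\<close>

lemma one_minus_herm_nonzero:
  assumes "norm z < 1" "norm a < 1"
  shows "1 - herm z a \<noteq> 0"
proof
  assume "1 - herm z a = 0"
  then have "1 \<le> norm z * norm a"
    using cmod_herm_le[of z a] by simp
  then show False
    using mult_strict_mono'[OF assms] by simp
qed

lemma ball_aut_has_derivative:
  assumes "1 - herm p a \<noteq> 0"
  shows "(ball_aut a has_derivative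
           (\<lambda>k. (1 / (1 - herm p a)) *s (- ball_aut_lin a k)
                + (herm k a / (1 - herm p a)\<^sup>2) *s (a - ball_aut_lin a p))) (at p)"
proof -
  note lin = bounded_linear_imp_has_derivative[OF bounded_linear_ball_aut_lin]
    bounded_linear_imp_has_derivative[OF bounded_linear_herm]
  have "((\<lambda>z. 1 / (1 - herm z a)) has_derivative (\<lambda>k. herm k a / (1 - herm p a)\<^sup>2)) (at p)"
    using assms by (auto intro!: derivative_eq_intros lin simp: power2_eq_square field_simps)
  moreover have "((\<lambda>z. a - ball_aut_lin a z) has_derivative (\<lambda>k. - ball_aut_lin a k)) (at p)"
    by (auto intro!: derivative_eq_intros lin)
  ultimately show ?thesis
    unfolding ball_aut_eq[abs_def]
    by (rule bounded_bilinear.FDERIV[OF bounded_bilinear_vector_scalar_mult])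
qed

lemma holomorphic_map2_ball_aut:
  assumes "a \<in> unit_ball2"
  shows "holomorphic_map2 (ball_aut a) unit_ball2"
  unfolding holomorphic_map2_def
proof (intro conjI ballI)
  fix p :: "complex^2"
  assume "p \<in> unit_ball2"
  then have "1 - herm p a \<noteq> 0"
    using assms by (intro one_minus_herm_nonzero) auto
  from ball_aut_has_derivative[OF this]
  show "\<exists>A. (ball_aut a has_derivative A) (at p) \<and> (\<forall>c v. A (c *s v) = c *s A v)"
    by (intro exI conjI) (assumption, simp add: ball_aut_lin_scale herm_simps vec_eq_iff algebra_simps)
qed simp

text \<open>The classical identity for \<open>1 - |ball_aut a z|^2\<close> with the denominator
  cleared. It is used to keep the image inside the ball.\<close>

lemma norm_ball_aut_numerator:
  assumes "norm a \<le> 1"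
  shows "(norm (a - ball_aut_lin a z))\<^sup>2 =
           (cmod (1 - herm z a))\<^sup>2 - (1 - (norm a)\<^sup>2) * (1 - (norm z)\<^sup>2)"
proof -
  define k where "k = herm z a / herm a a"
  define A where "A = herm a a"
  define s where "s = complex_of_real (sqrt (1 - (norm a)\<^sup>2))"
  have s: "s * s = 1 - A" "cnj s = s"
    using assms by (simp_all add: s_def A_def herm_self power_le_one flip: of_real_mult)
  \<comment> \<open>Splitting \<open>z = k *s a + q\<close> with \<open>q\<close> orthogonal to
    \<open>a\<close> removes all cross terms and leaves an identity in \<open>k\<close>,
    \<open>A\<close> and \<open>herm q q\<close>. For \<open>a = 0\<close>, the default
    \<open>k = 0\<close> gives \<open>q = z\<close>.\<close>
  define q where "q = z - k *s a"
  have c: "herm z a = k * A"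
    by (cases "a = 0") (simp_all add: k_def A_def herm_eq_0_iff herm_simps)
  have qa: "herm q a = 0"
    by (simp add: q_def herm_simps c flip: A_def)
  have aq: "herm a q = 0"
    using herm_commute[of a q] qa by simp
  have z: "z = k *s a + q"
    by (simp add: q_def)
  have zz: "herm z z = k * cnj k * A + herm q q"
    by (subst (1 2) z) (simp add: herm_simps qa aq A_def)
  have n: "a - ball_aut_lin a z = (1 - k) *s a - s *s q"
    by (simp add: ball_aut_lin_def proj_line_def q_def s_def vec_eq_iff flip: k_def)
      (simp add: scaleR_conv_of_real algebra_simps)
  have "cnj A = A"
    by (simp add: A_def herm_self)
  have "herm (a - ball_aut_lin a z) (a - ball_aut_lin a z) =
          (1 - k) * (1 - cnj k) * A + s * s * herm q q"
    unfolding n by (simp add: herm_simps qa aq s(2) A_def algebra_simps)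
  also have "\<dots> = (1 - herm z a) * cnj (1 - herm z a) - (1 - A) * (1 - herm z z)"
    unfolding zz c s(1) by (simp add: \<open>cnj A = A\<close> algebra_simps)
  finally have "complex_of_real ((norm (a - ball_aut_lin a z))\<^sup>2) =
      of_real ((cmod (1 - herm z a))\<^sup>2 - (1 - (norm a)\<^sup>2) * (1 - (norm z)\<^sup>2))"
    unfolding A_def herm_self complex_norm_square[symmetric] by simp
  then show ?thesis
    by (simp only: of_real_eq_iff)
qed

lemma ball_aut_in_ball:
  assumes "a \<in> unit_ball2" "z \<in> unit_ball2"
  shows "ball_aut a z \<in> unit_ball2"
proof -
  have "0 < (1 - (norm a)\<^sup>2) * (1 - (norm z)\<^sup>2)"
    using assms by (simp add: power_less_one_iff)
  then have "(norm (a - ball_aut_lin a z))\<^sup>2 < (cmod (1 - herm z a))\<^sup>2"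
    using norm_ball_aut_numerator[of a z] assms(1) by simp
  then have "norm (a - ball_aut_lin a z) < cmod (1 - herm z a)"
    by (rule power2_less_imp_less) simp
  moreover from this have "0 < cmod (1 - herm z a)"
    by (rule le_less_trans[OF norm_ge_zero])
  ultimately show ?thesis
    by (simp add: ball_aut_eq norm_vector_scalar_mult norm_divide del: vector_ssub_ldistrib)
qed

lemma ball_aut_0: "ball_aut a 0 = a"
  using linear_0[OF bounded_linear.linear[OF bounded_linear_ball_aut_lin]]
  by (simp add: ball_aut_eq herm_simps)

text \<open>The infinitesimal form, at \<open>a\<close>, of \<open>ball_aut a\<close> being an involution.\<close>

lemma ball_aut_derivative_inverse:
  assumes "a \<in> unit_ball2"
  shows "frechet_derivative (ball_aut a) (at 0) (frechet_derivative (ball_aut a) (at a) u) = u"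
proof -
  define t where "t = complex_of_real (1 - (norm a)\<^sup>2)"
  have "0 < 1 - (norm a)\<^sup>2"
    using assms by (simp add: power_less_one_iff)
  then have t: "t \<noteq> 0" "1 - herm a a = t" and nt: "of_real ((norm a)\<^sup>2) = 1 - t"
    unfolding t_def of_real_eq_0_iff by (simp_all add: herm_self)
  interpret L: bounded_linear "ball_aut_lin a"
    by (rule bounded_linear_ball_aut_lin)
  have "1 - herm a a \<noteq> 0" "1 - herm 0 a \<noteq> 0"
    using t by (simp_all add: herm_simps(9))
  note d = this[THEN ball_aut_has_derivative, THEN frechet_derivative_at, symmetric]
  \<comment> \<open>\<open>ball_aut_lin a\<close> fixes \<open>a\<close>, so the numerator vanishes
    at \<open>a\<close> and the quotient rule keeps only one term.\<close>
  have da: "frechet_derivative (ball_aut a) (at a) u = (- (1 / t)) *s ball_aut_lin a u"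
    unfolding d(1) by (simp add: ball_aut_lin_self t(2) vec_eq_iff)
  have d0: "frechet_derivative (ball_aut a) (at 0) k = herm k a *s a - ball_aut_lin a k" for k
    unfolding d(2) by (simp add: herm_simps(9) L.zero)
  have "frechet_derivative (ball_aut a) (at 0) (frechet_derivative (ball_aut a) (at a) u) =
      (- (1 / t)) *s (herm u a *s a - ball_aut_lin a (ball_aut_lin a u))"
    unfolding da d0 herm_simps(4) ball_aut_lin_scale herm_ball_aut_lin
      vector_smult_assoc[symmetric] vector_ssub_ldistrib ..
  also have "\<dots> = (- (1 / t)) *s
      ((1 - t) *s proj_line a u - (proj_line a u + t *s (u - proj_line a u)))"
    using assms by (simp only: herm_scale_eq_proj_line nt ball_aut_lin_twice t_def mem_ball_0 less_imp_le)
  \<comment> \<open>With \<open>P = proj_line a u\<close>, the bracket is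
    \<open>(1 - t) P - P - t (u - P) = - t u\<close>.\<close>
  also have "\<dots> = u"
    using t(1) by (simp add: vec_eq_iff field_simps)
  finally show ?thesis .
qed

section \<open>Comparison of the ball with the product domain\<close>

theorem theorem9:
  fixes D G :: "complex set" and f :: "complex^2 \<Rightarrow> complex^2"
    and a b u u\<^sub>s :: "complex^2"
  assumes "hyperbolic_domain D" and "hyperbolic_domain G"
    and "holomorphic_map2 f unit_ball2"
    and "f ` unit_ball2 \<subseteq> prod_domain D G"
    and "a \<in> unit_ball2"
    and "b = f a"
    and "u\<^sub>s = frechet_derivative f (at a) u"
  shows "Kob (prod_domain D G) b u\<^sub>s = (1/2) * (M_prod D G b u\<^sub>s * norm u\<^sub>s) \<and>
         (1/2) * (M_prod D G b u\<^sub>s * norm u\<^sub>s) \<le> M_ball a u * norm u"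
proof
  have b: "b \<in> prod_domain D G"
    using assms by blast
  show "Kob (prod_domain D G) b u\<^sub>s = (1/2) * (M_prod D G b u\<^sub>s * norm u\<^sub>s)"
    by (rule Kob_prod_domain[OF assms(1,2) b])
  \<comment> \<open>\<open>w\<close> is \<open>u\<close> transported to the centre; its norm is the
    right-hand side of the inequality.\<close>
  define w where "w = frechet_derivative (ball_aut a) (at a) u"
  have u: "frechet_derivative (ball_aut a) (at 0) w = u"
    unfolding w_def by (rule ball_aut_derivative_inverse[OF assms(5)])
  \<comment> \<open>The direction of \<open>w\<close>, normalized so that the disc
    \<open>t *s e\<close> stays in the ball. For \<open>w = 0\<close> division by zero gives
    \<open>e = 0\<close>, and the next two facts still hold.\<close>
  define e where "e = (1 / of_real (norm w)) *s w"
  have e: "norm e \<le> 1" "of_real (norm w) *s e = w"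
    by (auto simp: e_def norm_vector_scalar_mult norm_divide vector_smult_assoc)
  have ball: "t *s e \<in> unit_ball2" if "t \<in> unit_disk" for t
    using that e(1) mult_left_mono[of "norm e" 1 "cmod t"] by (simp add: norm_vector_scalar_mult)
  have image: "ball_aut a ` unit_ball2 \<subseteq> unit_ball2"
    using ball_aut_in_ball[OF assms(5)] by blast
  have disc: "holomorphic_disc (\<lambda>t. f (ball_aut a (t *s e)))"
    "frechet_derivative (\<lambda>t. f (ball_aut a (t *s e))) (at 0) h =
       frechet_derivative f (at (ball_aut a 0)) (frechet_derivative (ball_aut a) (at 0) (h *s e))" for h
    by (rule holomorphic_map2_disc[OF assms(3) holomorphic_map2_ball_aut[OF assms(5)] image],
        erule ball)+
  \<comment> \<open>The parameter vector \<open>norm w\<close> goes to \<open>w\<close> along the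
    linear disc, to \<open>u\<close> under the automorphism, and to the image vector under
    \<open>f\<close>.\<close>
  have "(1/2) * (M_prod D G b u\<^sub>s * norm u\<^sub>s) \<le> cmod (of_real (norm w))"
  proof (rule M_prod_le_disc[OF assms(1,2) disc(1)])
    show "(\<lambda>t. f (ball_aut a (t *s e))) ` unit_disk \<subseteq> prod_domain D G"
      using assms(4) ball_aut_in_ball[OF assms(5) ball] by blast
    show "f (ball_aut a (0 *s e)) = b"
      using assms(6) by (simp add: ball_aut_0)
    show "frechet_derivative (\<lambda>t. f (ball_aut a (t *s e))) (at 0) (of_real (norm w)) = u\<^sub>s"
      by (simp add: disc(2) e(2) u ball_aut_0 assms(7))
  qed
  also have "\<dots> = M_ball a u * norm u"
  proof (cases "u = 0")
    \<comment> \<open>Here \<open>M_ball\<close> is a quotient by \<open>0\<close>, so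
      \<open>w = 0\<close> has to come from linearity of the derivative.\<close>
    case True
    have "1 - herm a a \<noteq> 0"
      using assms(5) by (intro one_minus_herm_nonzero) auto
    then have "linear (frechet_derivative (ball_aut a) (at a))"
      by (rule linear_frechet_derivative[OF differentiableI[OF ball_aut_has_derivative]])
    then have "w = 0"
      unfolding w_def True by (rule linear_0)
    then show ?thesis using True by simp
  qed (simp add: M_ball_def w_def)
  finally show "(1/2) * (M_prod D G b u\<^sub>s * norm u\<^sub>s) \<le> M_ball a u * norm u" .
qed

end
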